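(* Let $J^3$ be the space of $3$-jets with coordinates $(x,y,u,u_x,u_y,u_{xx},u_{xy},u_{yy},u_{xxx},u_{xxy},u_{xyy},u_{yyy})$ and let $\mathcal{E}=\{(u_{xx}u_{yy}-u_{xy}^2)\cdot F=0\}\subset J^3$, where $$\begin{aligned}F={}&6 u_{xx} u_{xxx} u_{xy} u_{yy}u_{yyy}-6 u_{xx} u_{xxx} u_{xyy}u_{yy}^2-18 u_{xx} u_{xxy} u_{xy}u_{xyy} u_{yy}+12 u_{xx} u_{xxy}u_{xy}^2 u_{yyy}\\&-6 u_{xx}^2 u_{xxy}u_{yy} u_{yyy}+9 u_{xx} u_{xxy}^2u_{yy}^2-6 u_{xx}^2 u_{xy} u_{xyy}u_{yyy}+9 u_{xx}^2 u_{xyy}^2u_{yy}+u_{xx}^3 u_{yyy}^2-6 u_{xxx}u_{xxy} u_{xy} u_{yy}^2\\&+12 u_{xxx}u_{xy}^2 u_{xyy} u_{yy}-8 u_{xxx}u_{xy}^3 u_{yyy}+u_{xxx}^2 u_{yy}^3.\end{aligned}$$ Let $J^3_+$ and $J^3_-$ be the open subsets of $J^3$ where $u_{xx}u_{yy}-u_{xy}^2>0$ and $u_{xx}u_{yy}-u_{xy}^2<0$ respectively, and put $\mathcal{E}_\pm=\mathcal{E}\cap J^3_\pm$. Then $\mathcal{E}_+$ is a smooth submanifold of $J^3$ of codimension $2$, whereas $\mathcal{E}_-$ is the union $\mathcal{E}_-=\mathcal{E}_-^1\cup\mathcal{E}_-^2$ of two smooth hypersurfaces of $J^3$.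
   Context: $J^3$ is regarded here as the coordinate space $\mathbb{R}^{12}$ with the listed coordinates (the chart of $3$-jets of graphs $u=f(x,y)$ in $\mathbb{R}^3$). *)

theory Defs
  imports "HOL-Analysis.Analysis"
begin

text \<open>
  Smooth (\<open>C\<^sup>\<infinity>\<close>) maps on open sets. In finite dimension, being of class \<open>C\<^sup>k\<close> for every \<open>k\<close> is
  the same as having all iterated directional derivatives; the derivative in direction \<open>v\<close> at
  \<open>x\<close> is \<open>frechet_derivative f (at x) v\<close>. Only meant for open \<open>S\<close>.
\<close>

primrec Ck_on :: "nat \<Rightarrow> 'a::euclidean_space set \<Rightarrow> ('a \<Rightarrow> 'b::euclidean_space) \<Rightarrow> bool" where
  "Ck_on 0 S f \<longleftrightarrow> continuous_on S f"
| "Ck_on (Suc k) S f \<longleftrightarrow>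
     (\<forall>x\<in>S. f differentiable (at x)) \<and> (\<forall>v. Ck_on k S (\<lambda>x. frechet_derivative f (at x) v))"

definition smooth_on :: "'a::euclidean_space set \<Rightarrow> ('a \<Rightarrow> 'b::euclidean_space) \<Rightarrow> bool" where
  "smooth_on S f \<longleftrightarrow> (\<forall>k. Ck_on k S f)"

definition diffeomorphism ::
    "'a::euclidean_space set \<Rightarrow> 'b::euclidean_space set \<Rightarrow> ('a \<Rightarrow> 'b) \<Rightarrow> ('b \<Rightarrow> 'a) \<Rightarrow> bool" where
  "diffeomorphism U V f g \<longleftrightarrow> homeomorphism U V f g \<and> smooth_on U f \<and> smooth_on V g"

text \<open>
  Embedded smooth submanifolds of codimension \<open>k\<close>, by slice charts: near each of its points,
  \<open>M\<close> is straightened by a diffeomorphism between open sets to the subspace on which \<open>k\<close> of the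
  Cartesian coordinates vanish. Submanifolds are nonempty, so that the codimension is determined;
  they need not be closed or connected.
\<close>

definition smooth_submanifold :: "nat \<Rightarrow> 'a::euclidean_space set \<Rightarrow> bool" where
  "smooth_submanifold k M \<longleftrightarrow> M \<noteq> {} \<and>
     (\<forall>p\<in>M. \<exists>U V \<phi> \<psi> B. open U \<and> p \<in> U \<and> open V \<and>
        diffeomorphism U V \<phi> (\<psi> :: 'a \<Rightarrow> 'a) \<and> B \<subseteq> Basis \<and> card B = k \<and>
        \<phi> ` (M \<inter> U) = {z \<in> V. \<forall>b\<in>B. z \<bullet> b = 0})"

abbreviation smooth_hypersurface :: "'a::euclidean_space set \<Rightarrow> bool" where
  "smooth_hypersurface \<equiv> smooth_submanifold 1"

datatype jet_coord = Jx | Jy | Ju | Jux | Juy | Juxx | Juxy | Juyy | Juxxx | Juxxy | Juxyy | Juyyy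

lemma UNIV_jet_coord:
  "(UNIV :: jet_coord set) =
     {Jx, Jy, Ju, Jux, Juy, Juxx, Juxy, Juyy, Juxxx, Juxxy, Juxyy, Juyyy}"
  using jet_coord.exhaust by blast

instance jet_coord :: finite
  by standard (simp add: UNIV_jet_coord)

type_synonym jet3 = "real ^ jet_coord"

lemma DIM_jet3: "DIM(jet3) = 12"
  by (simp add: UNIV_jet_coord)

definition hess :: "jet3 \<Rightarrow> real" where
  "hess p = p $ Juxx * p $ Juyy - (p $ Juxy)\<^sup>2"

definition F :: "jet3 \<Rightarrow> real" where
  "F p = (let uxx = p $ Juxx; uxy = p $ Juxy; uyy = p $ Juyy;
              uxxx = p $ Juxxx; uxxy = p $ Juxxy; uxyy = p $ Juxyy; uyyy = p $ Juyyy
    in 6 * uxx * uxxx * uxy * uyy * uyyy - 6 * uxx * uxxx * uxyy * uyy^2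
       - 18 * uxx * uxxy * uxy * uxyy * uyy + 12 * uxx * uxxy * uxy^2 * uyyy
       - 6 * uxx^2 * uxxy * uyy * uyyy + 9 * uxx * uxxy^2 * uyy^2
       - 6 * uxx^2 * uxy * uxyy * uyyy + 9 * uxx^2 * uxyy^2 * uyy
       + uxx^3 * uyyy^2 - 6 * uxxx * uxxy * uxy * uyy^2
       + 12 * uxxx * uxy^2 * uxyy * uyy - 8 * uxxx * uxy^3 * uyyy
       + uxxx^2 * uyy^3)"

definition \<E> :: "jet3 set" where
  "\<E> = {p. hess p * F p = 0}"

definition J3_plus :: "jet3 set" where
  "J3_plus = {p. hess p > 0}"

definition J3_minus :: "jet3 set" where
  "J3_minus = {p. hess p < 0}"

definition \<E>_plus :: "jet3 set" where
  "\<E>_plus = \<E> \<inter> J3_plus"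

definition \<E>_minus :: "jet3 set" where
  "\<E>_minus = \<E> \<inter> J3_minus"

end

theory Submission
  imports Defs
begin

text \<open>
  The function \<open>F\<close> is the resultant of the quadratic form \<open>Q = u\<^sub>x\<^sub>x X\<^sup>2 + 2 u\<^sub>x\<^sub>y X Y + u\<^sub>y\<^sub>y Y\<^sup>2\<close> and the binary cubic form
  \<open>C\<close> of the third derivatives, so it vanishes iff \<open>Q\<close> and \<open>C\<close> have a common root. If \<open>Q\<close> is
  definite, its roots are complex conjugate, hence \<open>F = 0\<close> iff \<open>Q\<close> divides \<open>C\<close>; this
  determines \<open>u\<^sub>x\<^sub>y\<^sub>y\<close> and \<open>u\<^sub>y\<^sub>y\<^sub>y\<close> smoothly in terms of the other coordinates. If \<open>Q\<close> is indefinite,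
  its two real roots can be labelled globally by the sign of the square root of the discriminant, and
  the vanishing of \<open>C\<close> at either of them is a linear equation for \<open>u\<^sub>x\<^sub>x\<^sub>x\<close> or \<open>u\<^sub>y\<^sub>y\<^sub>y\<close>.
\<close>

section \<open>Resultant and division identities for the two binary forms\<close>

definition cubic :: "jet3 \<Rightarrow> real \<Rightarrow> real \<Rightarrow> real" where
  "cubic x X Y = x $ Juxxx * X^3 + 3 * x $ Juxxy * X^2 * Y + 3 * x $ Juxyy * X * Y^2 + x $ Juyyy * Y^3"

text \<open>Both \<open>(e, u_xx)\<close> and \<open>(u_yy, e)\<close> are zeros of
  \<open>Q\<close>. If \<open>e'\<close> is the other solution, then
  \<open>e * e' = u_xx * u_yy\<close>, so the second vector is a multiple of
  \<open>(e', u_xx)\<close>. The left side is thus the product of \<open>C\<close> over the two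
  roots of \<open>Q\<close>, and \<open>e^3\<close> comes from the chosen scaling.\<close>

lemma F_resultant:
  assumes "e^2 + 2 * x $ Juxy * e + x $ Juxx * x $ Juyy = 0"
  shows "cubic x e (x $ Juxx) * cubic x (x $ Juyy) e = e^3 * F x"
  using assms unfolding cubic_def F_def Let_def by algebra

lemma cubic_scale: "cubic x (t * X) (t * Y) = t^3 * cubic x X Y"
  unfolding cubic_def by algebra

text \<open>
  \<open>\<alpha> X + \<beta> Y\<close> is the quotient and \<open>3 r X Y\<^sup>2 + s Y\<^sup>3\<close> the remainder of the cubic form modulo the
  quadratic one.
\<close>

lemma F_division:
  fixes \<alpha> \<beta> r s :: real
  assumes "x $ Juxxx = x $ Juxx * \<alpha>"
    and "3 * x $ Juxxy = 2 * x $ Juxy * \<alpha> + x $ Juxx * \<beta>"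
    and "3 * x $ Juxyy = x $ Juyy * \<alpha> + 2 * x $ Juxy * \<beta> + 3 * r"
    and "x $ Juyyy = x $ Juyy * \<beta> + s"
  shows "F x = x $ Juxx * ((x $ Juxx * s - 3 * x $ Juxy * r)\<^sup>2 + 9 * r\<^sup>2 * hess x)"
proof -
  \<comment> \<open>Taking thirds expresses the third derivatives without denominators, so the goal
    becomes a polynomial identity.\<close>
  define A B where "A = \<alpha> / 3" and "B = \<beta> / 3"
  have eqs: "x $ Juxxx = 3 * x $ Juxx * A" "x $ Juxxy = 2 * x $ Juxy * A + x $ Juxx * B"
    "x $ Juxyy = x $ Juyy * A + 2 * x $ Juxy * B + r" "x $ Juyyy = 3 * x $ Juyy * B + s"
    using assms by (simp_all add: A_def B_def)
  \<comment> \<open>Reducing \<open>C\<close> modulo \<open>Q\<close> preserves the resultant. For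
    the remainder \<open>Y^2 (3 r X + s Y)\<close> it equals \<open>u_xx^2 * Q(s, -3 r)\<close>, and
    the right side is this with the square completed.\<close>
  show ?thesis
    unfolding F_def hess_def Let_def eqs by algebra
qed

section \<open>Calculus of maps of class \<open>Ck_on\<close>\<close>

text \<open>Derivatives depend only on values near a point, so on an open set agreement of the
  functions passes to all directional derivatives.\<close>

lemma Ck_on_cong:
  assumes "open S" "\<And>x. x \<in> S \<Longrightarrow> f x = g x" "Ck_on k S f"
  shows "Ck_on k S g"
  using assms(2,3)
proof (induction k arbitrary: f g)
  case 0
  then show ?case by (simp cong: continuous_on_cong)
next
  case (Suc k)
  have D: "(g has_derivative frechet_derivative f (at x)) (at x)" if "x \<in> S" for x
  proof (rule has_derivative_transform_within_open[OF _ assms(1) that])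
    show "(f has_derivative frechet_derivative f (at x)) (at x)"
      using Suc.prems(2) that by (simp add: frechet_derivative_works)
  qed (use Suc.prems(1) in auto)
  show ?case
    unfolding Ck_on.simps
  proof (intro conjI allI ballI)
    show "g differentiable at x" if "x \<in> S" for x
      using D[OF that] by (auto simp: differentiable_def)
    show "Ck_on k S (\<lambda>x. frechet_derivative g (at x) v)" for v
    proof (rule Suc.IH)
      show "Ck_on k S (\<lambda>x. frechet_derivative f (at x) v)"
        using Suc.prems(2) by simp
      show "frechet_derivative f (at x) v = frechet_derivative g (at x) v" if "x \<in> S" for x
        using frechet_derivative_at[OF D[OF that]] by simp
    qed
  qed
qed

text \<open>Allows an explicit derivative formula in place of the chosen
  \<open>frechet_derivative\<close>, by uniqueness of derivatives.\<close>

lemma Ck_on_SucI: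
  assumes "open S"
    and "\<And>x. x \<in> S \<Longrightarrow> (f has_derivative f' x) (at x)"
    and "\<And>v. Ck_on k S (\<lambda>x. f' x v)"
  shows "Ck_on (Suc k) S f"
  unfolding Ck_on.simps
proof (intro conjI allI ballI)
  show "f differentiable at x" if "x \<in> S" for x
    using assms(2)[OF that] by (auto simp: differentiable_def)
  show "Ck_on k S (\<lambda>x. frechet_derivative f (at x) v)" for v
  proof (rule Ck_on_cong[OF assms(1) _ assms(3)])
    show "f' x v = frechet_derivative f (at x) v" if "x \<in> S" for x
      using frechet_derivative_at[OF assms(2)[OF that]] by simp
  qed
qed

lemma Ck_on_Suc_has_derivative:
  assumes "Ck_on (Suc k) S f" "x \<in> S"
  shows "(f has_derivative frechet_derivative f (at x)) (at x)"
  using assms by (simp add: frechet_derivative_works)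

text \<open>The product rule retains undifferentiated factors; this lowers their order to that of
  the induction hypothesis.\<close>

lemma Ck_on_SucD: "Ck_on (Suc k) S f \<Longrightarrow> Ck_on k S f"
proof (induction k arbitrary: f)
  case 0
  then show ?case
    by (auto intro!: continuous_at_imp_continuous_on differentiable_imp_continuous_within)
next
  case (Suc k)
  have "f differentiable at x" if "x \<in> S" for x
    using Suc.prems that by simp
  moreover have "Ck_on k S (\<lambda>x. frechet_derivative f (at x) v)" for v
    using Suc.prems unfolding Ck_on.simps(2)[of "Suc k"] by (intro Suc.IH) blast
  ultimately show ?case
    unfolding Ck_on.simps(2)[of k] by blast
qed

lemma Ck_on_const: "open S \<Longrightarrow> Ck_on k S (\<lambda>x. c)"
proof (induction k arbitrary: c)
  case (Suc k)
  then show ?case by (auto intro!: Ck_on_SucI[where f' = "\<lambda>x v. 0"])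
qed simp

lemma Ck_on_bounded_linear:
  assumes "open S" "bounded_linear f"
  shows "Ck_on k S f"
proof (cases k)
  case 0
  then show ?thesis using assms(2) by (simp add: linear_continuous_on)
next
  case (Suc j)
  then show ?thesis
    using assms
    by (auto intro!: Ck_on_SucI[where f' = "\<lambda>x. f"] bounded_linear_imp_has_derivative Ck_on_const
        simp del: Ck_on.simps)
qed

lemma Ck_on_add:
  assumes "open S"
  shows "Ck_on k S f \<Longrightarrow> Ck_on k S g \<Longrightarrow> Ck_on k S (\<lambda>x. f x + g x)"
proof (induction k arbitrary: f g)
  case 0
  then show ?case by (simp add: continuous_on_add)
next
  case (Suc k)
  show ?case
  proof (rule Ck_on_SucI[OF assms])
    show "((\<lambda>x. f x + g x) has_derivative
        (\<lambda>v. frechet_derivative f (at x) v + frechet_derivative g (at x) v)) (at x)" if "x \<in> S" for x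
      using Suc.prems that by (intro has_derivative_add Ck_on_Suc_has_derivative)
  qed (use Suc in auto)
qed

lemma Ck_on_scaleR:
  fixes f :: "'a::euclidean_space \<Rightarrow> real"
  assumes "open S"
  shows "Ck_on k S f \<Longrightarrow> Ck_on k S g \<Longrightarrow> Ck_on k S (\<lambda>x. f x *\<^sub>R g x)"
proof (induction k arbitrary: f g)
  case 0
  then show ?case by (simp add: continuous_on_scaleR)
next
  case (Suc k)
  show ?case
  proof (rule Ck_on_SucI[OF assms])
    show "((\<lambda>x. f x *\<^sub>R g x) has_derivative
        (\<lambda>v. f x *\<^sub>R frechet_derivative g (at x) v + frechet_derivative f (at x) v *\<^sub>R g x)) (at x)"
      if "x \<in> S" for x
      using Suc.prems that by (intro has_derivative_scaleR Ck_on_Suc_has_derivative)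
    show "Ck_on k S (\<lambda>x. f x *\<^sub>R frechet_derivative g (at x) v
        + frechet_derivative f (at x) v *\<^sub>R g x)" for v
      using Suc.prems Suc.prems[THEN Ck_on_SucD] by (intro Ck_on_add assms Suc.IH) simp_all
  qed
qed

text \<open>The derivative of \<open>1 / f\<close> is a product of \<open>f'\<close> and two copies
  of \<open>1 / f\<close>, so order \<open>k\<close> for \<open>1 / f\<close> yields order
  \<open>Suc k\<close>.\<close>

lemma Ck_on_inverse:
  fixes f :: "'a::euclidean_space \<Rightarrow> real"
  assumes "open S" "\<And>x. x \<in> S \<Longrightarrow> f x \<noteq> 0"
  shows "Ck_on k S f \<Longrightarrow> Ck_on k S (\<lambda>x. inverse (f x))"
proof (induction k)
  case 0
  then show ?case using assms(2) by (simp add: continuous_on_inverse)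
next
  case (Suc k)
  have I: "Ck_on k S (\<lambda>x. inverse (f x))"
    by (rule Suc.IH[OF Ck_on_SucD[OF Suc.prems]])
  show ?case
  proof (rule Ck_on_SucI[OF assms(1)])
    show "((\<lambda>x. inverse (f x)) has_derivative
        (\<lambda>v. (- 1) *\<^sub>R inverse (f x) *\<^sub>R frechet_derivative f (at x) v *\<^sub>R inverse (f x))) (at x)"
      if "x \<in> S" for x
      using Deriv.has_derivative_inverse[OF assms(2)[OF that] Ck_on_Suc_has_derivative[OF Suc.prems that]]
      by (simp add: mult.assoc)
    show "Ck_on k S
        (\<lambda>x. (- 1) *\<^sub>R inverse (f x) *\<^sub>R frechet_derivative f (at x) v *\<^sub>R inverse (f x))" for v
      using Suc.prems by (intro Ck_on_scaleR Ck_on_const assms(1) I) auto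
  qed
qed

text \<open>The derivative \<open>f' / (2 sqrt f)\<close> contains \<open>sqrt f\<close> again, so
  the induction hypothesis together with \<open>Ck_on_inverse\<close> controls it.\<close>

lemma Ck_on_sqrt:
  fixes f :: "'a::euclidean_space \<Rightarrow> real"
  assumes "open S" "\<And>x. x \<in> S \<Longrightarrow> f x > 0"
  shows "Ck_on k S f \<Longrightarrow> Ck_on k S (\<lambda>x. sqrt (f x))"
proof (induction k)
  case 0
  then show ?case by (simp add: continuous_on_real_sqrt)
next
  case (Suc k)
  have I: "Ck_on k S (\<lambda>x. inverse (sqrt (f x)))"
  proof (rule Ck_on_inverse[OF assms(1)])
    show "sqrt (f x) \<noteq> 0" if "x \<in> S" for x
      using assms(2)[OF that] by simp
  qed (rule Suc.IH[OF Ck_on_SucD[OF Suc.prems]])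
  show ?case
  proof (rule Ck_on_SucI[OF assms(1)])
    show "((\<lambda>x. sqrt (f x)) has_derivative
        (\<lambda>v. (1/2) *\<^sub>R inverse (sqrt (f x)) *\<^sub>R frechet_derivative f (at x) v)) (at x)"
      if "x \<in> S" for x
      using has_derivative_real_sqrt[OF assms(2)[OF that] Ck_on_Suc_has_derivative[OF Suc.prems that]]
      by (simp add: field_simps)
    show "Ck_on k S (\<lambda>x. (1/2) *\<^sub>R inverse (sqrt (f x)) *\<^sub>R frechet_derivative f (at x) v)" for v
      using Suc.prems by (intro Ck_on_scaleR Ck_on_const assms(1) I) auto
  qed
qed

section \<open>Closure rules for smooth maps\<close>

named_theorems smooth_intros

lemma smooth_on_const [smooth_intros]: "open S \<Longrightarrow> smooth_on S (\<lambda>x. c)"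
  by (simp add: smooth_on_def Ck_on_const)

lemma smooth_on_bounded_linear: "open S \<Longrightarrow> bounded_linear f \<Longrightarrow> smooth_on S f"
  by (simp add: smooth_on_def Ck_on_bounded_linear)

lemma smooth_on_id [smooth_intros]: "open S \<Longrightarrow> smooth_on S (\<lambda>x. x)"
  by (simp add: smooth_on_bounded_linear)

lemma smooth_on_nth [smooth_intros]:
  "open S \<Longrightarrow> smooth_on S (\<lambda>x::real^'n. x $ i)"
  by (simp add: smooth_on_bounded_linear bounded_linear_vec_nth)

lemma smooth_on_add [smooth_intros]:
  "open S \<Longrightarrow> smooth_on S f \<Longrightarrow> smooth_on S g \<Longrightarrow> smooth_on S (\<lambda>x. f x + g x)"
  by (simp add: smooth_on_def Ck_on_add)

lemma smooth_on_sum [smooth_intros]: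
  "open S \<Longrightarrow> (\<And>i. i \<in> I \<Longrightarrow> smooth_on S (f i)) \<Longrightarrow> smooth_on S (\<lambda>x. \<Sum>i\<in>I. f i x)"
  by (induction I rule: infinite_finite_induct) (simp_all add: smooth_on_const smooth_on_add)

lemma smooth_on_scaleR [smooth_intros]:
  "open S \<Longrightarrow> smooth_on S f \<Longrightarrow> smooth_on S g \<Longrightarrow> smooth_on S (\<lambda>x. f x *\<^sub>R g x)"
  by (simp add: smooth_on_def Ck_on_scaleR)

lemma smooth_on_minus [smooth_intros]:
  "open S \<Longrightarrow> smooth_on S f \<Longrightarrow> smooth_on S (\<lambda>x. - f x)"
  using smooth_on_scaleR[OF _ smooth_on_const, of S f "-1"] by simp

lemma smooth_on_diff [smooth_intros]:
  "open S \<Longrightarrow> smooth_on S f \<Longrightarrow> smooth_on S g \<Longrightarrow> smooth_on S (\<lambda>x. f x - g x)"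
  using smooth_on_add[of S f "\<lambda>x. - g x"] by (simp add: smooth_on_minus)

lemma smooth_on_mult [smooth_intros]:
  fixes f g :: "'a::euclidean_space \<Rightarrow> real"
  shows "open S \<Longrightarrow> smooth_on S f \<Longrightarrow> smooth_on S g \<Longrightarrow> smooth_on S (\<lambda>x. f x * g x)"
  using smooth_on_scaleR[of S f g] by simp

lemma smooth_on_power [smooth_intros]:
  fixes f :: "'a::euclidean_space \<Rightarrow> real"
  shows "open S \<Longrightarrow> smooth_on S f \<Longrightarrow> smooth_on S (\<lambda>x. f x ^ n)"
  by (induction n) (simp_all add: smooth_intros)

lemma smooth_on_divide [smooth_intros]:
  fixes f g :: "'a::euclidean_space \<Rightarrow> real"
  assumes "open S" "smooth_on S f" "smooth_on S g" "\<And>x. x \<in> S \<Longrightarrow> g x \<noteq> 0"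
  shows "smooth_on S (\<lambda>x. f x / g x)"
  using assms smooth_on_mult[of S f "\<lambda>x. inverse (g x)"]
  by (simp add: divide_inverse smooth_on_def Ck_on_inverse)

lemma smooth_on_sqrt [smooth_intros]:
  fixes f :: "'a::euclidean_space \<Rightarrow> real"
  assumes "open S" "smooth_on S f" "\<And>x. x \<in> S \<Longrightarrow> f x > 0"
  shows "smooth_on S (\<lambda>x. sqrt (f x))"
  using assms by (simp add: smooth_on_def Ck_on_sqrt)

lemma smooth_on_imp_continuous_on: "smooth_on S f \<Longrightarrow> continuous_on S f"
  unfolding smooth_on_def by (metis Ck_on.simps(1))

section \<open>Submanifolds presented as graphs\<close>

text \<open>
  The chart is the shear \<open>x \<mapsto> x - g x\<close>, whose inverse is \<open>x \<mapsto> x + g x\<close> because \<open>g\<close> depends only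
  on the coordinates outside \<open>B\<close>, which the shear fixes.
\<close>

lemma smooth_submanifold_graphI:
  fixes M :: "'a::euclidean_space set"
  assumes "M \<noteq> {}"
    and "\<And>p. p \<in> M \<Longrightarrow> \<exists>U B g. open U \<and> p \<in> U \<and> B \<subseteq> Basis \<and> card B = k \<and> smooth_on U g \<and>
      (\<forall>x. \<forall>b\<in>Basis - B. g x \<bullet> b = 0) \<and>
      (\<forall>x\<in>U. \<forall>y. (\<forall>b\<in>Basis - B. y \<bullet> b = x \<bullet> b) \<longrightarrow> y \<in> U \<and> g y = g x) \<and>
      M \<inter> U = {x \<in> U. \<forall>b\<in>B. x \<bullet> b = g x \<bullet> b}"
  shows "smooth_submanifold k M"
  unfolding smooth_submanifold_def
proof (intro conjI ballI assms(1))
  fix p assume "p \<in> M"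
  from assms(2)[OF this] obtain U B g where U: "open U" "p \<in> U" and B: "B \<subseteq> Basis" "card B = k"
    and g: "smooth_on U g" and g0: "\<forall>x. \<forall>b\<in>Basis - B. g x \<bullet> b = 0"
    and inv: "\<forall>x\<in>U. \<forall>y. (\<forall>b\<in>Basis - B. y \<bullet> b = x \<bullet> b) \<longrightarrow> y \<in> U \<and> g y = g x"
    and M: "M \<inter> U = {x \<in> U. \<forall>b\<in>B. x \<bullet> b = g x \<bullet> b}"
    by (elim exE conjE) (rule that)
  define \<phi> \<psi> where "\<phi> = (\<lambda>x. x - g x)" and "\<psi> = (\<lambda>x. x + g x)"
  have \<phi>: "\<phi> x \<in> U" "g (\<phi> x) = g x" if "x \<in> U" for x
  proof -
    have "\<forall>b\<in>Basis - B. \<phi> x \<bullet> b = x \<bullet> b"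
      using g0 by (simp add: \<phi>_def inner_diff_left)
    with inv that show "\<phi> x \<in> U" "g (\<phi> x) = g x" by blast+
  qed
  have \<psi>: "\<psi> x \<in> U" "g (\<psi> x) = g x" if "x \<in> U" for x
  proof -
    have "\<forall>b\<in>Basis - B. \<psi> x \<bullet> b = x \<bullet> b"
      using g0 by (simp add: \<psi>_def inner_add_left)
    with inv that show "\<psi> x \<in> U" "g (\<psi> x) = g x" by blast+
  qed
  have \<phi>\<psi>: "\<phi> (\<psi> x) = x" "\<psi> (\<phi> x) = x" if "x \<in> U" for x
    using \<phi>[OF that] \<psi>[OF that] by (simp_all add: \<phi>_def \<psi>_def)
  have smooth: "smooth_on U \<phi>" "smooth_on U \<psi>"
    unfolding \<phi>_def \<psi>_def by (intro smooth_intros U g)+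
  have "homeomorphism U U \<phi> \<psi>"
    using \<phi> \<psi> \<phi>\<psi> smooth by (intro homeomorphismI) (auto intro: smooth_on_imp_continuous_on)
  moreover have "\<phi> ` (M \<inter> U) = {z \<in> U. \<forall>b\<in>B. z \<bullet> b = 0}"
  proof (intro equalityI subsetI)
    fix z assume "z \<in> \<phi> ` (M \<inter> U)"
    then show "z \<in> {z \<in> U. \<forall>b\<in>B. z \<bullet> b = 0}"
      using \<phi>(1) unfolding M by (auto simp: \<phi>_def inner_diff_left)
  next
    fix z assume z: "z \<in> {z \<in> U. \<forall>b\<in>B. z \<bullet> b = 0}"
    then have "\<psi> z \<in> M \<inter> U"
      using \<psi>[of z] unfolding M by (auto simp: \<psi>_def inner_add_left)
    then show "z \<in> \<phi> ` (M \<inter> U)"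
      using z \<phi>\<psi>(1)[of z] by (auto intro: rev_image_eqI)
  qed
  ultimately show "\<exists>U V \<phi> \<psi> B. open U \<and> p \<in> U \<and> open V \<and>
        diffeomorphism U V \<phi> (\<psi> :: 'a \<Rightarrow> 'a) \<and> B \<subseteq> Basis \<and> card B = k \<and>
        \<phi> ` (M \<inter> U) = {z \<in> V. \<forall>b\<in>B. z \<bullet> b = 0}"
    using U B smooth unfolding diffeomorphism_def by blast
qed

text \<open>The preceding criterion with \<open>B\<close> the axes indexed by \<open>I\<close>; the
  scalar functions \<open>h i\<close> are assembled into one vector-valued \<open>g\<close>
  supported on these axes.\<close>

lemma smooth_submanifold_coord_graphI:
  fixes M :: "(real^'n) set"
  assumes "M \<noteq> {}"
    and "\<And>p. p \<in> M \<Longrightarrow> \<exists>U I h. open U \<and> p \<in> U \<and> card I = k \<and> (\<forall>i\<in>I. smooth_on U (h i)) \<and>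
      (\<forall>x\<in>U. \<forall>y. (\<forall>j. j \<notin> I \<longrightarrow> y $ j = x $ j) \<longrightarrow> y \<in> U \<and> (\<forall>i\<in>I. h i y = h i x)) \<and>
      M \<inter> U = {x \<in> U. \<forall>i\<in>I. x $ i = h i x}"
  shows "smooth_submanifold k M"
proof (rule smooth_submanifold_graphI[OF assms(1)])
  fix p assume "p \<in> M"
  from assms(2)[OF this] obtain U I h where U: "open U" "p \<in> U" and I: "card I = k"
    and h: "\<forall>i\<in>I. smooth_on U (h i)"
    and inv: "\<forall>x\<in>U. \<forall>y. (\<forall>j. j \<notin> I \<longrightarrow> y $ j = x $ j) \<longrightarrow> y \<in> U \<and> (\<forall>i\<in>I. h i y = h i x)"
    and M: "M \<inter> U = {x \<in> U. \<forall>i\<in>I. x $ i = h i x}"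
    by (elim exE conjE) (rule that)
  define B :: "(real^'n) set" where "B = (\<lambda>i. axis i 1) ` I"
  define g :: "real^'n \<Rightarrow> real^'n" where "g = (\<lambda>x. \<Sum>i\<in>I. h i x *\<^sub>R axis i 1)"
  have g_nth: "g x $ j = (if j \<in> I then h j x else 0)" for x j
    by (simp add: g_def axis_def if_distrib[of "\<lambda>t. _ * t"] sum.delta cong: if_cong)
  have outside: "(\<forall>b\<in>Basis - B. P b) \<longleftrightarrow> (\<forall>j. j \<notin> I \<longrightarrow> P (axis j 1))" for P
    by (auto simp: B_def Basis_vec_def axis_eq_axis)
  have "card B = k"
    unfolding B_def I[symmetric] by (intro card_image inj_onI) (simp add: axis_eq_axis)
  moreover have "B \<subseteq> Basis"
    by (auto simp: B_def)
  moreover have "smooth_on U g"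
    using h unfolding g_def by (intro smooth_intros U) simp
  moreover have "\<forall>x. \<forall>b\<in>Basis - B. g x \<bullet> b = 0"
    by (simp only: outside) (simp add: inner_axis g_nth)
  moreover have "\<forall>x\<in>U. \<forall>y. (\<forall>b\<in>Basis - B. y \<bullet> b = x \<bullet> b) \<longrightarrow> y \<in> U \<and> g y = g x"
  proof (intro ballI allI impI)
    fix x y assume "x \<in> U" "\<forall>b\<in>Basis - B. y \<bullet> b = x \<bullet> b"
    then have "\<forall>j. j \<notin> I \<longrightarrow> y $ j = x $ j"
      by (simp only: outside) (simp add: inner_axis)
    with inv \<open>x \<in> U\<close> have "y \<in> U \<and> (\<forall>i\<in>I. h i y = h i x)" by blast
    then show "y \<in> U \<and> g y = g x" by (simp add: g_def)
  qed
  moreover have "M \<inter> U = {x \<in> U. \<forall>b\<in>B. x \<bullet> b = g x \<bullet> b}"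
    unfolding M by (auto simp: B_def inner_axis g_nth)
  ultimately show "\<exists>U B g. open U \<and> p \<in> U \<and> B \<subseteq> Basis \<and> card B = k \<and> smooth_on U g \<and>
      (\<forall>x. \<forall>b\<in>Basis - B. g x \<bullet> b = 0) \<and>
      (\<forall>x\<in>U. \<forall>y. (\<forall>b\<in>Basis - B. y \<bullet> b = x \<bullet> b) \<longrightarrow> y \<in> U \<and> g y = g x) \<and>
      M \<inter> U = {x \<in> U. \<forall>b\<in>B. x \<bullet> b = g x \<bullet> b}"
    using U by blast
qed

section \<open>Indefinite case: the two sheets\<close>

text \<open>For \<sigma> = 1 or -1, this is \<open>u_xx\<close> times a root \<open>X / Y\<close> of
  \<open>Q\<close>. The scaling keeps it smooth where \<open>u_xx\<close> vanishes.\<close>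

definition qroot :: "real \<Rightarrow> jet3 \<Rightarrow> real" where
  "qroot \<sigma> x = - x $ Juxy + \<sigma> * sqrt (- hess x)"

lemma qroot_quadratic:
  assumes "\<sigma>\<^sup>2 = 1" "hess x < 0"
  shows "(qroot \<sigma> x)^2 + 2 * x $ Juxy * qroot \<sigma> x + x $ Juxx * x $ Juyy = 0"
proof -
  define d where "d = sqrt (- hess x)"
  have "d\<^sup>2 = (x $ Juxy)\<^sup>2 - x $ Juxx * x $ Juyy"
    using assms(2) by (simp add: d_def hess_def)
  with assms(1) show ?thesis
    unfolding qroot_def d_def[symmetric] by algebra
qed

lemma qroot_mult:
  assumes "\<sigma>\<^sup>2 = 1" "hess x < 0"
  shows "qroot \<sigma> x * qroot (- \<sigma>) x = x $ Juxx * x $ Juyy"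
proof -
  define d where "d = sqrt (- hess x)"
  have "d\<^sup>2 = (x $ Juxy)\<^sup>2 - x $ Juxx * x $ Juyy"
    using assms(2) by (simp add: d_def hess_def)
  with assms(1) show ?thesis
    unfolding qroot_def d_def[symmetric] by algebra
qed

text \<open>The two values differ by a nonzero multiple of the square root. Consequently the two
  kinds of chart used below cover each sheet.\<close>

lemma qroot_nonzero:
  assumes "\<sigma>\<^sup>2 = 1" "hess x < 0"
  shows "qroot \<sigma> x \<noteq> 0 \<or> qroot (- \<sigma>) x \<noteq> 0"
proof -
  have "qroot \<sigma> x - qroot (- \<sigma>) x = 2 * \<sigma> * sqrt (- hess x)"
    by (simp add: qroot_def)
  moreover have "\<sigma> \<noteq> 0" "sqrt (- hess x) \<noteq> 0"
    using assms by auto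
  ultimately show ?thesis by auto
qed

text \<open>
  With \<open>d = sqrt (- hess x)\<close>, the vectors \<open>(- u\<^sub>x\<^sub>y + \<sigma> d, u\<^sub>x\<^sub>x)\<close> and \<open>(u\<^sub>y\<^sub>y, - u\<^sub>x\<^sub>y - \<sigma> d)\<close> are proportional and
  represent the same root of the quadratic form, but one of them may vanish; they never both do.
\<close>

definition sheet :: "real \<Rightarrow> jet3 set" where
  "sheet \<sigma> = {x. hess x < 0 \<and> cubic x (qroot \<sigma> x) (x $ Juxx) = 0 \<and>
     cubic x (x $ Juyy) (qroot (- \<sigma>) x) = 0}"

text \<open>By \<open>qroot_mult\<close>, scaling the second vector by
  \<open>qroot \<sigma> x\<close> and the first by \<open>u_yy\<close> gives the same vector, and
  similarly with \<open>qroot (- \<sigma>) x\<close> and \<open>u_xx\<close>; the cubic form is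
  homogeneous of degree 3.\<close>

lemma sheet_proportional:
  assumes "\<sigma>\<^sup>2 = 1" "hess x < 0"
  shows "(qroot \<sigma> x)^3 * cubic x (x $ Juyy) (qroot (- \<sigma>) x)
           = (x $ Juyy)^3 * cubic x (qroot \<sigma> x) (x $ Juxx)"
    and "(qroot (- \<sigma>) x)^3 * cubic x (qroot \<sigma> x) (x $ Juxx)
           = (x $ Juxx)^3 * cubic x (x $ Juyy) (qroot (- \<sigma>) x)"
  using qroot_mult[OF assms] by (simp_all add: cubic_scale[symmetric] mult.commute)

text \<open>Where a cube on the left of \<open>sheet_proportional\<close> is nonzero, one equation
  implies the other.\<close>

lemma mem_sheet_iff:
  assumes "\<sigma>\<^sup>2 = 1" "hess x < 0"
  shows "qroot \<sigma> x \<noteq> 0 \<Longrightarrow> x \<in> sheet \<sigma> \<longleftrightarrow> cubic x (qroot \<sigma> x) (x $ Juxx) = 0"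
    and "qroot (- \<sigma>) x \<noteq> 0 \<Longrightarrow> x \<in> sheet \<sigma> \<longleftrightarrow> cubic x (x $ Juyy) (qroot (- \<sigma>) x) = 0"
  using sheet_proportional[OF assms] assms(2) by (auto simp: sheet_def)

lemma E_minus_eq: "\<E>_minus = sheet 1 \<union> sheet (- 1)"
proof -
  \<comment> \<open>In \<open>F_resultant\<close> with \<open>e = qroot \<sigma> x\<close>, the
    first factor is the first equation of \<open>sheet \<sigma>\<close> and the second factor is the
    second equation of \<open>sheet (- \<sigma>)\<close>. Since \<open>e\<close> is nonzero, each
    alone decides membership.\<close>
  have "F x = 0 \<longleftrightarrow> x \<in> sheet \<sigma> \<or> x \<in> sheet (- \<sigma>)"
    if "\<sigma>\<^sup>2 = 1" "hess x < 0" "qroot \<sigma> x \<noteq> 0" for x \<sigma>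
    using F_resultant[OF qroot_quadratic[OF that(1,2)]] that
      mem_sheet_iff(1)[of \<sigma> x] mem_sheet_iff(2)[of "- \<sigma>" x]
    by (metis (no_types, lifting) add.inverse_inverse mult_eq_0_iff power2_minus power_not_zero)
  from this[of 1] this[of "-1"]
  have "F x = 0 \<longleftrightarrow> x \<in> sheet 1 \<or> x \<in> sheet (- 1)" if "hess x < 0" for x
    using qroot_nonzero[of 1 x] that by auto
  then show ?thesis
    by (auto simp: \<E>_minus_def \<E>_def J3_minus_def) (auto simp: sheet_def)
qed

lemma continuous_on_hess [continuous_intros]: "continuous_on S hess"
  unfolding hess_def by (intro continuous_intros)

lemma open_qroot: "open {x. hess x < 0 \<and> qroot \<sigma> x \<noteq> 0}"
  unfolding qroot_def
  by (intro open_Collect_conj open_Collect_less open_Collect_neq continuous_intros)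

lemma smooth_on_hess [smooth_intros]: "open S \<Longrightarrow> smooth_on S hess"
  unfolding hess_def by (intro smooth_intros)

lemma smooth_on_qroot [smooth_intros]:
  "open S \<Longrightarrow> (\<And>x. x \<in> S \<Longrightarrow> hess x < 0) \<Longrightarrow> smooth_on S (qroot \<sigma>)"
  unfolding qroot_def by (intro smooth_intros) auto

lemma eq_minus_divide_iff: "d \<noteq> 0 \<Longrightarrow> u = - (n / d) \<longleftrightarrow> u * d + n = (0::real)"
  by (auto simp: field_simps)

lemma smooth_hypersurface_sheet:
  assumes "\<sigma>\<^sup>2 = 1"
  shows "smooth_hypersurface (sheet \<sigma>)"
proof (rule smooth_submanifold_coord_graphI)
  \<comment> \<open>Here \<open>Q = 2 X Y\<close> and \<open>C = 0\<close>.\<close>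
  have "axis Juxy 1 \<in> sheet \<sigma>"
    by (simp add: sheet_def hess_def cubic_def axis_def)
  then show "sheet \<sigma> \<noteq> {}" by blast
next
  fix p assume p: "p \<in> sheet \<sigma>"
  then have "hess p < 0" by (simp add: sheet_def)
  from qroot_nonzero[OF assms this]
  show "\<exists>U I h. open U \<and> p \<in> U \<and> card I = 1 \<and> (\<forall>i\<in>I. smooth_on U (h i)) \<and>
      (\<forall>x\<in>U. \<forall>y. (\<forall>j. j \<notin> I \<longrightarrow> y $ j = x $ j) \<longrightarrow> y \<in> U \<and> (\<forall>i\<in>I. h i y = h i x)) \<and>
      sheet \<sigma> \<inter> U = {x \<in> U. \<forall>i\<in>I. x $ i = h i x}"
  proof
    assume p0: "qroot \<sigma> p \<noteq> 0"
    define U where "U = {x. hess x < 0 \<and> qroot \<sigma> x \<noteq> 0}"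
    \<comment> \<open>The terms of the cubic form at \<open>(qroot \<sigma> x, u_xx)\<close> free of
      \<open>u_xxx\<close>. The coefficient of \<open>u_xxx\<close> is the cube of
      \<open>qroot \<sigma> x\<close>, nonzero on \<open>U\<close>, so \<open>h\<close> solves for
      \<open>u_xxx\<close>.\<close>
    define n where "n = (\<lambda>x. 3 * x $ Juxxy * (qroot \<sigma> x)^2 * x $ Juxx
      + 3 * x $ Juxyy * qroot \<sigma> x * (x $ Juxx)^2 + x $ Juyyy * (x $ Juxx)^3)"
    define h where "h = (\<lambda>x. - n x / (qroot \<sigma> x)^3)"
    have U: "open U" unfolding U_def by (rule open_qroot)
    have "\<forall>i\<in>{Juxxx}. smooth_on U h"
      unfolding h_def n_def by (intro ballI smooth_intros U) (auto simp: U_def)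
    moreover have "x \<in> sheet \<sigma> \<longleftrightarrow> x $ Juxxx = h x" if "x \<in> U" for x
    proof -
      have "cubic x (qroot \<sigma> x) (x $ Juxx) = x $ Juxxx * (qroot \<sigma> x)^3 + n x"
        by (simp add: cubic_def n_def)
      with that mem_sheet_iff(1)[OF assms, of x] show ?thesis
        by (simp add: U_def h_def eq_minus_divide_iff)
    qed
    then have "sheet \<sigma> \<inter> U = {x \<in> U. \<forall>i\<in>{Juxxx}. x $ i = h x}" by auto
    moreover have "\<forall>x\<in>U. \<forall>y. (\<forall>j. j \<notin> {Juxxx} \<longrightarrow> y $ j = x $ j) \<longrightarrow>
        y \<in> U \<and> (\<forall>i\<in>{Juxxx}. h y = h x)"
      by (auto simp: U_def h_def n_def qroot_def hess_def)
    moreover have "p \<in> U" using p0 \<open>hess p < 0\<close> by (simp add: U_def)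
    moreover have "card {Juxxx} = 1" by simp
    ultimately show ?thesis
      using U by (intro exI[of _ U] exI[of _ "{Juxxx}"] exI[of _ "\<lambda>_. h"] conjI)
  next
    assume p0: "qroot (- \<sigma>) p \<noteq> 0"
    define U where "U = {x. hess x < 0 \<and> qroot (- \<sigma>) x \<noteq> 0}"
    \<comment> \<open>Now the second vector is used: its \<open>Y\<close>-entry is nonzero on
      \<open>U\<close>, so the equation is solved for \<open>u_yyy\<close>.\<close>
    define n where "n = (\<lambda>x. x $ Juxxx * (x $ Juyy)^3 + 3 * x $ Juxxy * (x $ Juyy)^2 * qroot (- \<sigma>) x
      + 3 * x $ Juxyy * x $ Juyy * (qroot (- \<sigma>) x)^2)"
    define h where "h = (\<lambda>x. - n x / (qroot (- \<sigma>) x)^3)"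
    have U: "open U" unfolding U_def by (rule open_qroot)
    have "\<forall>i\<in>{Juyyy}. smooth_on U h"
      unfolding h_def n_def by (intro ballI smooth_intros U) (auto simp: U_def)
    moreover have "x \<in> sheet \<sigma> \<longleftrightarrow> x $ Juyyy = h x" if "x \<in> U" for x
    proof -
      have "cubic x (x $ Juyy) (qroot (- \<sigma>) x) = x $ Juyyy * (qroot (- \<sigma>) x)^3 + n x"
        by (simp add: cubic_def n_def)
      with that mem_sheet_iff(2)[OF assms, of x] show ?thesis
        by (simp add: U_def h_def eq_minus_divide_iff)
    qed
    then have "sheet \<sigma> \<inter> U = {x \<in> U. \<forall>i\<in>{Juyyy}. x $ i = h x}" by auto
    moreover have "\<forall>x\<in>U. \<forall>y. (\<forall>j. j \<notin> {Juyyy} \<longrightarrow> y $ j = x $ j) \<longrightarrow>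
        y \<in> U \<and> (\<forall>i\<in>{Juyyy}. h y = h x)"
      by (auto simp: U_def h_def n_def qroot_def hess_def)
    moreover have "p \<in> U" using p0 \<open>hess p < 0\<close> by (simp add: U_def)
    moreover have "card {Juyyy} = 1" by simp
    ultimately show ?thesis
      using U by (intro exI[of _ U] exI[of _ "{Juyyy}"] exI[of _ "\<lambda>_. h"] conjI)
  qed
qed

text \<open>Ensures that the decomposition is not one hypersurface listed twice.\<close>

lemma sheets_distinct: "sheet 1 \<noteq> sheet (- 1)"
proof -
  \<comment> \<open>Here \<open>Q = 2 X Y\<close> and \<open>C = X^3\<close>: the root
    \<open>X = 0\<close>, labelled 1, annihilates \<open>C\<close>, while \<open>Y = 0\<close>,
    labelled -1, does not.\<close>
  define x :: jet3 where "x = axis Juxy 1 + axis Juxxx 1"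
  have x: "x $ Juxx = 0" "x $ Juyy = 0" "x $ Juxy = 1" "x $ Juxxx = 1" "x $ Juxxy = 0"
    "x $ Juxyy = 0" "x $ Juyyy = 0"
    by (simp_all add: x_def axis_def)
  have "x \<in> sheet 1" "x \<notin> sheet (- 1)"
    by (simp_all add: sheet_def cubic_def qroot_def hess_def x)
  then show ?thesis by auto
qed

section \<open>Definite case: codimension two\<close>

lemma smooth_submanifold_E_plus: "smooth_submanifold 2 \<E>_plus"
proof (rule smooth_submanifold_coord_graphI)
  \<comment> \<open>Here \<open>Q = X^2 + Y^2\<close> and \<open>C = 0\<close>.\<close>
  have "axis Juxx 1 + axis Juyy 1 \<in> \<E>_plus"
    by (simp add: \<E>_plus_def \<E>_def J3_plus_def F_def hess_def axis_def)
  then show "\<E>_plus \<noteq> {}" by blast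
next
  fix p assume p: "p \<in> \<E>_plus"
  \<comment> \<open>The quotient coefficients of \<open>C\<close> by \<open>Q\<close>, read off from
    the two leading terms. A positive \<open>hess\<close> forces \<open>u_xx\<close> to be nonzero,
    so all of \<open>J3_plus\<close> serves as one domain.\<close>
  define \<alpha> \<beta> :: "jet3 \<Rightarrow> real" where "\<alpha> = (\<lambda>x. x $ Juxxx / x $ Juxx)"
    and "\<beta> = (\<lambda>x. (3 * x $ Juxxy - 2 * x $ Juxy * \<alpha> x) / x $ Juxx)"
  \<comment> \<open>The values of \<open>u_xyy\<close> and \<open>u_yyy\<close> that make the
    remainder vanish; the \<open>else\<close> branch is meant for \<open>Juyyy\<close>.\<close>
  define h where "h = (\<lambda>i x. if i = Juxyy then (x $ Juyy * \<alpha> x + 2 * x $ Juxy * \<beta> x) / 3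
    else x $ Juyy * \<beta> x)"
  have U: "open J3_plus"
    unfolding J3_plus_def by (intro open_Collect_less continuous_intros)
  have uxx: "x $ Juxx \<noteq> 0" if "x \<in> J3_plus" for x
    using that by (auto simp: J3_plus_def hess_def)
  have "smooth_on J3_plus \<alpha>"
    unfolding \<alpha>_def by (intro smooth_intros U uxx)
  moreover from this have "smooth_on J3_plus \<beta>"
    unfolding \<beta>_def by (intro smooth_intros U uxx)
  ultimately have "\<forall>i\<in>{Juxyy, Juyyy}. smooth_on J3_plus (h i)"
    unfolding h_def by (auto intro!: smooth_intros U)
  moreover have "x \<in> \<E>_plus \<longleftrightarrow> x $ Juxyy = h Juxyy x \<and> x $ Juyyy = h Juyyy x"
    if x: "x \<in> J3_plus" for x
  proof -
    define r s where "r = x $ Juxyy - h Juxyy x" and "s = x $ Juyyy - h Juyyy x"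
    have "F x = x $ Juxx * ((x $ Juxx * s - 3 * x $ Juxy * r)\<^sup>2 + 9 * r\<^sup>2 * hess x)"
    proof (rule F_division)
      show "x $ Juxxx = x $ Juxx * \<alpha> x"
        using uxx[OF x] by (simp add: \<alpha>_def)
      show "3 * x $ Juxxy = 2 * x $ Juxy * \<alpha> x + x $ Juxx * \<beta> x"
        using uxx[OF x] by (simp add: \<beta>_def)
      show "3 * x $ Juxyy = x $ Juyy * \<alpha> x + 2 * x $ Juxy * \<beta> x + 3 * r"
        "x $ Juyyy = x $ Juyy * \<beta> x + s"
        by (simp_all add: r_def s_def h_def field_simps)
    qed
    moreover have "hess x > 0" using x by (simp add: J3_plus_def)
    \<comment> \<open>Both summands in the bracket are nonnegative. Vanishing of the second gives
      \<open>r = 0\<close>, and then the first gives \<open>s = 0\<close>.\<close>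
    ultimately have "F x = 0 \<longleftrightarrow> r = 0 \<and> s = 0"
      using uxx[OF x] by (auto simp: add_nonneg_eq_0_iff)
    then show ?thesis
      using x \<open>hess x > 0\<close> by (auto simp: \<E>_plus_def \<E>_def r_def s_def)
  qed
  then have "\<E>_plus \<inter> J3_plus = {x \<in> J3_plus. \<forall>i\<in>{Juxyy, Juyyy}. x $ i = h i x}"
    by auto
  moreover have "\<forall>x\<in>J3_plus. \<forall>y. (\<forall>j. j \<notin> {Juxyy, Juyyy} \<longrightarrow> y $ j = x $ j) \<longrightarrow>
      y \<in> J3_plus \<and> (\<forall>i\<in>{Juxyy, Juyyy}. h i y = h i x)"
    by (auto simp: J3_plus_def hess_def h_def \<alpha>_def \<beta>_def)
  moreover have "p \<in> J3_plus" using p by (simp add: \<E>_plus_def)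
  moreover have "card {Juxyy, Juyyy} = 2" by simp
  ultimately show "\<exists>U I h. open U \<and> p \<in> U \<and> card I = 2 \<and> (\<forall>i\<in>I. smooth_on U (h i)) \<and>
      (\<forall>x\<in>U. \<forall>y. (\<forall>j. j \<notin> I \<longrightarrow> y $ j = x $ j) \<longrightarrow> y \<in> U \<and> (\<forall>i\<in>I. h i y = h i x)) \<and>
      \<E>_plus \<inter> U = {x \<in> U. \<forall>i\<in>I. x $ i = h i x}"
    using U by (intro exI[of _ J3_plus] exI[of _ "{Juxyy, Juyyy}"] exI[of _ h] conjI)
qed

theorem proposition3p3:
  shows "smooth_submanifold 2 \<E>_plus \<and>
    (\<exists>\<E>1 \<E>2. smooth_hypersurface \<E>1 \<and> smooth_hypersurface \<E>2 \<and> \<E>1 \<noteq> \<E>2 \<and>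
       \<E>_minus = \<E>1 \<union> \<E>2)"
  using smooth_submanifold_E_plus smooth_hypersurface_sheet[of 1] smooth_hypersurface_sheet[of "-1"]
    sheets_distinct E_minus_eq by auto

end
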